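(* Let $\mathcal{G}$ be a compact, finite, connected quantum graph with vertex set $V$ and edge set $E$, with edge lengths $\ell_e>0$, having no multiple edges between the same pair of vertices and at most one loop at each vertex, with at least one vertex of degree $1$, and with $V_N\ne\emptyset$. Let $c>0$ be such that $$\widetilde{w}_{xx}:=\sum_{y\sim x}c\,\ell_{yx}-\sum_{y\sim x}\frac{1}{c\,\ell_{yx}}>0\qquad\text{for all }x\in V_N.$$ Then $$T_q(\mathcal{G})=\frac{1}{12}\sum_{e\in E}\ell_e^3+\frac14\,\frac1{c^3}\,T_{m^{G_c}}(V_N).$$
   Context: $V_D:=\{x\in V:\deg_{\mathcal{G}}(x)=1\}$ (Dirichlet vertices; degree = number of edges incident at $x$, a loop counting twice) and $V_N:=V\setminus V_D$. We write $x\sim y$ if there is an edge joining $x$ and $y$ (so $x\sim x$ if there is a loop at $x$), $\ell_{xy}=\ell_{yx}$ for the length of that edge ($\ell_{xx}$ the length of the loop at $x$), and $\ell_{xx}=0$ if there is no loop at $x$. Sums over $y\sim x$ include $y=x$ (once) when there is a loop at $x$. Each edge $e$ is identified with $[0,\ell_e]$, and $\int_{\mathcal{G}}u\,dx:=\sum_{e\in E}\int_0^{\ell_e}[u]_e(x_e)\,dx_e$. The torsion function $v$ of $\mathcal{G}$ is the solution of $-\Delta_{\mathcal{G}}v=1$ on $\mathcal{G}$, $v=0$ on $V_D$; i.e. $v$ is continuous on $\mathcal{G}$, $-v''=1$ on each edge, $v=0$ at vertices in $V_D$, and at each vertex in $V_N$ the Kirchhoff condition holds (the sum of the outgoing derivatives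 over all incident edge-ends is $0$). The quantum torsional rigidity is $T_q(\mathcal{G}):=\int_{\mathcal{G}}|v|\,dx$. $G_c$ is the weighted discrete graph with vertex set $V$ and symmetric weights: $w_{yx}=\frac{1}{c\,\ell_{yx}}$ if $y\sim x$, $y\ne x$; for $x\in V_N$, $w_{xx}=\frac{1}{c\,\ell_{xx}}+c\,\ell_{xx}+\widetilde{w}_{xx}$ if $\ell_{xx}\ne0$ and $w_{xx}=\widetilde{w}_{xx}$ if $\ell_{xx}=0$; all other weights are $0$ (in particular $w_{xx}=0$ for $x\in V_D$). With $d_x:=\sum_{y\in V}w_{xy}$, the associated random walk is $m^{G_c}_x=\frac{1}{d_x}\sum_{y}w_{xy}\delta_y$, with reversible measure $\nu_{G_c}(A)=\sum_{x\in A}d_x$. Its torsional rigidity on $V_N$ is $T_{m^{G_c}}(V_N):=\sum_{x\in V_N}d_x f(x)$, where $f:V\to\mathbb{R}$ is the unique solution of $-\frac1{d_x}\sum_{y\in V}w_{xy}(f(y)-f(x))=1$ for $x\in V_N$, $f(x)=0$ for $x\in V_D$ (note $V_D=\{x\in V\setminus V_N:m_x^{G_c}(V_N)>0\}$ when $V_N\neq\emptyset$). *)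

theory Defs
  imports "HOL-Analysis.Analysis" "Graph_Theory.Digraph_Component"
begin

text \<open>
  A quantum graph is a finite digraph \<open>G\<close> (loops and parallel arcs allowed) with edge lengths \<open>l\<close>.
  The direction of an arc \<open>e\<close> only fixes the identification of the edge with the interval
  \<open>{0..l e}\<close>: the coordinate \<open>0\<close> is at \<open>tail G e\<close> and \<open>l e\<close> is at \<open>head G e\<close>. Connectedness is that
  of the underlying undirected graph; the name is qualified because \<open>connected\<close> alone clashes with
  topological connectedness.
\<close>

locale quantum_graph = fin_digraph G for G :: "('a, 'b) pre_digraph" (structure) +
  fixes l :: "'b \<Rightarrow> real"
  assumes connected_graph: "Digraph_Component.connected G"
    and length_pos: "e \<in> arcs G \<Longrightarrow> l e > 0"

text \<open>
  At most one edge between any two vertices, irrespective of direction; the case of equal end points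
  says that there is at most one loop at each vertex. (The locale \<open>nomulti_digraph\<close> would still
  admit a pair of antiparallel arcs.)
\<close>

definition no_multiple_edges :: "('a, 'b) pre_digraph \<Rightarrow> bool" where
  "no_multiple_edges G \<longleftrightarrow>
     (\<forall>e\<in>arcs G. \<forall>e'\<in>arcs G. {tail G e, head G e} = {tail G e', head G e'} \<longrightarrow> e = e')"

text \<open>A loop is both an out-arc and an in-arc of its vertex, so it counts twice.\<close>

definition vertex_degree :: "('a, 'b) pre_digraph \<Rightarrow> 'a \<Rightarrow> nat" where
  "vertex_degree G x = out_degree G x + in_degree G x"

definition dirichlet_verts :: "('a, 'b) pre_digraph \<Rightarrow> 'a set" where
  "dirichlet_verts G = {x \<in> verts G. vertex_degree G x = 1}"

definition kirchhoff_verts :: "('a, 'b) pre_digraph \<Rightarrow> 'a set" where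
  "kirchhoff_verts G = verts G - dirichlet_verts G"

definition joins :: "('a, 'b) pre_digraph \<Rightarrow> 'b \<Rightarrow> 'a \<Rightarrow> 'a \<Rightarrow> bool" where
  "joins G e x y \<longleftrightarrow> e \<in> arcs G \<and> {tail G e, head G e} = {x, y}"

definition adj :: "('a, 'b) pre_digraph \<Rightarrow> 'a \<Rightarrow> 'a \<Rightarrow> bool" where
  "adj G x y \<longleftrightarrow> (\<exists>e. joins G e x y)"

definition nbrs :: "('a, 'b) pre_digraph \<Rightarrow> 'a \<Rightarrow> 'a set" where
  "nbrs G x = {y \<in> verts G. adj G y x}"

text \<open>Meaningful for graphs without multiple edges; \<open>0\<close> for non-adjacent vertices.\<close>

definition edge_length :: "('a, 'b) pre_digraph \<Rightarrow> ('b \<Rightarrow> real) \<Rightarrow> 'a \<Rightarrow> 'a \<Rightarrow> real" where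
  "edge_length G l x y = (if adj G x y then l (THE e. joins G e x y) else 0)"


text \<open>
  A function on the quantum graph is a family \<open>u\<close>, with \<open>u e\<close> a function on \<open>{0..l e}\<close>
  (extensional, so that two families that agree on the graph are equal). It is continuous on the
  graph if each \<open>u e\<close> is continuous and the end values fit together to a function \<open>U\<close> on vertices.
\<close>

definition graph_functions ::
    "('a, 'b) pre_digraph \<Rightarrow> ('b \<Rightarrow> real) \<Rightarrow> ('b \<Rightarrow> real \<Rightarrow> real) set" where
  "graph_functions G l = (\<Pi>\<^sub>E e\<in>arcs G. {0..l e} \<rightarrow>\<^sub>E UNIV)"

definition continuous_on_graph ::
    "('a, 'b) pre_digraph \<Rightarrow> ('b \<Rightarrow> real) \<Rightarrow> ('b \<Rightarrow> real \<Rightarrow> real) \<Rightarrow> ('a \<Rightarrow> real) \<Rightarrow> bool" where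
  "continuous_on_graph G l u U \<longleftrightarrow>
     (\<forall>e\<in>arcs G. continuous_on {0..l e} (u e) \<and> u e 0 = U (tail G e) \<and> u e (l e) = U (head G e))"

definition graph_integral ::
    "('a, 'b) pre_digraph \<Rightarrow> ('b \<Rightarrow> real) \<Rightarrow> ('b \<Rightarrow> real \<Rightarrow> real) \<Rightarrow> real" where
  "graph_integral G l u = (\<Sum>e\<in>arcs G. integral {0..l e} (u e))"

definition edge_deriv ::
    "('b \<Rightarrow> real) \<Rightarrow> ('b \<Rightarrow> real \<Rightarrow> real) \<Rightarrow> 'b \<Rightarrow> real \<Rightarrow> real" where
  "edge_deriv l u e t = vector_derivative (u e) (at t within {0..l e})"

text \<open>A loop at \<open>x\<close> contributes at both of its ends.\<close>

definition kirchhoff ::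
    "('a, 'b) pre_digraph \<Rightarrow> ('b \<Rightarrow> real) \<Rightarrow> ('b \<Rightarrow> real \<Rightarrow> real) \<Rightarrow> 'a \<Rightarrow> bool" where
  "kirchhoff G l u x \<longleftrightarrow>
     (\<Sum>e\<in>out_arcs G x. edge_deriv l u e 0) + (\<Sum>e\<in>in_arcs G x. - edge_deriv l u e (l e)) = 0"

definition is_torsion_function ::
    "('a, 'b) pre_digraph \<Rightarrow> ('b \<Rightarrow> real) \<Rightarrow> ('b \<Rightarrow> real \<Rightarrow> real) \<Rightarrow> bool" where
  "is_torsion_function G l v \<longleftrightarrow>
     v \<in> graph_functions G l \<and>
     (\<exists>U. continuous_on_graph G l v U \<and> (\<forall>x\<in>dirichlet_verts G. U x = 0)) \<and>
     (\<forall>e\<in>arcs G. \<forall>t\<in>{0..l e}.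
        v e differentiable (at t within {0..l e}) \<and>
        (edge_deriv l v e has_real_derivative - 1) (at t within {0..l e})) \<and>
     (\<forall>x\<in>kirchhoff_verts G. kirchhoff G l v x)"

definition torsion_function ::
    "('a, 'b) pre_digraph \<Rightarrow> ('b \<Rightarrow> real) \<Rightarrow> 'b \<Rightarrow> real \<Rightarrow> real" where
  "torsion_function G l = (THE v. is_torsion_function G l v)"

definition quantum_torsional_rigidity :: "('a, 'b) pre_digraph \<Rightarrow> ('b \<Rightarrow> real) \<Rightarrow> real" where
  "quantum_torsional_rigidity G l = graph_integral G l (\<lambda>e t. \<bar>torsion_function G l e t\<bar>)"


text \<open>
  A weighted discrete graph is a vertex set \<open>V\<close> with symmetric weights \<open>w\<close>. Its random walk jumps from
  \<open>x\<close> to \<open>y\<close> with probability \<open>w x y / weighted_degree V w x\<close>, and the weighted degree is the density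
  of the reversible measure.
\<close>

definition weighted_degree :: "'a set \<Rightarrow> ('a \<Rightarrow> 'a \<Rightarrow> real) \<Rightarrow> 'a \<Rightarrow> real" where
  "weighted_degree V w x = (\<Sum>y\<in>V. w x y)"

definition rw_laplacian ::
    "'a set \<Rightarrow> ('a \<Rightarrow> 'a \<Rightarrow> real) \<Rightarrow> ('a \<Rightarrow> real) \<Rightarrow> 'a \<Rightarrow> real" where
  "rw_laplacian V w f x = 1 / weighted_degree V w x * (\<Sum>y\<in>V. w x y * (f y - f x))"

text \<open>
  The Dirichlet condition is imposed on all of \<open>V - \<Omega>\<close>. Only the values at the points of \<open>V - \<Omega>\<close> from
  which the walk can jump into \<open>\<Omega>\<close> influence the equation on \<open>\<Omega>\<close>.
\<close>

definition is_rw_torsion_function ::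
    "'a set \<Rightarrow> ('a \<Rightarrow> 'a \<Rightarrow> real) \<Rightarrow> 'a set \<Rightarrow> ('a \<Rightarrow> real) \<Rightarrow> bool" where
  "is_rw_torsion_function V w \<Omega> f \<longleftrightarrow>
     f \<in> V \<rightarrow>\<^sub>E UNIV \<and>
     (\<forall>x\<in>\<Omega>. - rw_laplacian V w f x = 1) \<and>
     (\<forall>x\<in>V - \<Omega>. f x = 0)"

definition rw_torsion_function ::
    "'a set \<Rightarrow> ('a \<Rightarrow> 'a \<Rightarrow> real) \<Rightarrow> 'a set \<Rightarrow> 'a \<Rightarrow> real" where
  "rw_torsion_function V w \<Omega> = (THE f. is_rw_torsion_function V w \<Omega> f)"

definition rw_torsional_rigidity :: "'a set \<Rightarrow> ('a \<Rightarrow> 'a \<Rightarrow> real) \<Rightarrow> 'a set \<Rightarrow> real" where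
  "rw_torsional_rigidity V w \<Omega> = (\<Sum>x\<in>\<Omega>. weighted_degree V w x * rw_torsion_function V w \<Omega> x)"


definition loop_excess :: "('a, 'b) pre_digraph \<Rightarrow> ('b \<Rightarrow> real) \<Rightarrow> real \<Rightarrow> 'a \<Rightarrow> real" where
  "loop_excess G l c x =
     (\<Sum>y\<in>nbrs G x. c * edge_length G l y x) - (\<Sum>y\<in>nbrs G x. 1 / (c * edge_length G l y x))"

text \<open>The weights of the discrete graph \<open>G\<^sub>c\<close>; the loop weight at \<open>x\<close> is positive even if \<open>G\<close> has no
  loop there, as soon as \<open>loop_excess G l c x > 0\<close>.\<close>

definition discrete_weight ::
    "('a, 'b) pre_digraph \<Rightarrow> ('b \<Rightarrow> real) \<Rightarrow> real \<Rightarrow> 'a \<Rightarrow> 'a \<Rightarrow> real" where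
  "discrete_weight G l c x y =
     (if x \<noteq> y then (if adj G x y then 1 / (c * edge_length G l x y) else 0)
      else if x \<in> kirchhoff_verts G then
        (if edge_length G l x x \<noteq> 0
         then 1 / (c * edge_length G l x x) + c * edge_length G l x x + loop_excess G l c x
         else loop_excess G l c x)
      else 0)"

end

theory Submission
  imports Defs
begin

text \<open>
  On an edge of length \<open>L\<close> the equation \<open>- v'' = 1\<close> forces \<open>v t = a (1 - t/L) + b t/L + t (L - t)/2\<close>,
  where \<open>a\<close> and \<open>b\<close> are the values at the ends. Hence \<open>v\<close> is determined by its vertex values \<open>U\<close>, and
  the Kirchhoff condition becomes a linear equation for \<open>U\<close>: the sum of \<open>(U y - U x)/\<ell>\<^sub>x\<^sub>y\<close> over the
  edge-ends at \<open>x\<close> equals \<open>- S x / 2\<close>, where \<open>S x\<close> is the total length of the edge-ends at \<open>x\<close>. The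
  weights of \<open>G\<^sub>c\<close> are such that its weighted degree is \<open>c S\<close>, so that \<open>2 c\<^sup>2 U\<close> is the torsion
  function of the random walk. As \<open>U\<close> is nonnegative by the minimum principle, integrating the
  edge profiles gives the formula, with \<open>\<Sum>x. S x * U x / 2\<close> coming from the affine parts.
\<close>

section \<open>Finite linear systems\<close>

text \<open>Gaussian elimination, by induction on the set of columns: a pivot row \<open>r\<close>
  eliminates the unknown \<open>s\<close>, and both squareness and triviality of the kernel pass to
  the remaining system.\<close>

lemma linear_system_solvable:
  fixes A :: "'i \<Rightarrow> 'j \<Rightarrow> real"
  assumes "finite C" "finite R" "card R = card C"
    and "\<And>f. (\<And>i. i \<in> R \<Longrightarrow> (\<Sum>j\<in>C. A i j * f j) = 0) \<Longrightarrow> \<forall>j\<in>C. f j = 0"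
  shows "\<exists>f. \<forall>i\<in>R. (\<Sum>j\<in>C. A i j * f j) = b i"
  using assms
proof (induction C arbitrary: R A b rule: finite_induct)
  case empty
  then show ?case by simp
next
  case (insert s C)
  have "\<exists>r\<in>R. A r s \<noteq> 0"
  proof (rule ccontr)
    assume "\<not> ?thesis"
    \<comment> \<open>If column \<open>s\<close> vanished, the indicator function of
      \<open>s\<close> would be a nonzero kernel vector.\<close>
    then have "\<And>i. i \<in> R \<Longrightarrow> (\<Sum>j\<in>insert s C. A i j * of_bool (j = s)) = 0"
      using insert.hyps by (simp add: sum.neutral)
    from insert.prems(3)[OF this] show False by simp
  qed
  then obtain r where r: "r \<in> R" "A r s \<noteq> 0" by blast
  \<comment> \<open>\<open>A'\<close> is the Schur complement of the pivot entry.
    \<open>ext \<beta> f\<close> assigns to \<open>s\<close> the value for which row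
    \<open>r\<close> evaluates to \<open>\<beta>\<close>.\<close>
  define A' where "A' i j = A i j - A i s * A r j / A r s" for i j
  define ext where "ext \<beta> f = f(s := (\<beta> - (\<Sum>j\<in>C. A r j * f j)) / A r s)" for \<beta> and f :: "'j \<Rightarrow> real"
  have ext_C: "(\<Sum>j\<in>C. A i j * ext \<beta> f j) = (\<Sum>j\<in>C. A i j * f j)" for i \<beta> f
    using insert.hyps by (intro sum.cong) (auto simp: ext_def)
  have pivot: "(\<Sum>j\<in>insert s C. A r j * ext \<beta> f j) = \<beta>" for \<beta> f
    using insert.hyps r by (simp add: ext_C) (simp add: ext_def)
  have A'_sum: "(\<Sum>j\<in>C. A' i j * f j) = (\<Sum>j\<in>C. A i j * f j) - A i s / A r s * (\<Sum>j\<in>C. A r j * f j)" for i f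
    by (simp add: A'_def left_diff_distrib sum_subtractf sum_distrib_left mult.assoc)
  have eliminated: "(\<Sum>j\<in>insert s C. A i j * ext \<beta> f j) = (\<Sum>j\<in>C. A' i j * f j) + A i s * \<beta> / A r s" for i \<beta> f
    using insert.hyps r by (simp add: ext_C A'_sum) (simp add: ext_def field_simps)
  have "\<exists>f. \<forall>i\<in>R - {r}. (\<Sum>j\<in>C. A' i j * f j) = b i - A i s * b r / A r s"
  proof (rule insert.IH)
    show "finite (R - {r})" "card (R - {r}) = card C"
      using insert.prems insert.hyps r by auto
    fix f assume "\<And>i. i \<in> R - {r} \<Longrightarrow> (\<Sum>j\<in>C. A' i j * f j) = 0"
    \<comment> \<open>With \<open>\<beta> = 0\<close>, a kernel vector of \<open>A'\<close> extends
      to one of \<open>A\<close>: row \<open>r\<close> holds by \<open>pivot\<close>, the other rows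
      by \<open>eliminated\<close>.\<close>
    then have "\<And>i. i \<in> R \<Longrightarrow> (\<Sum>j\<in>insert s C. A i j * ext 0 f j) = 0"
      using pivot eliminated[of _ 0 f] by (metis Diff_iff add.right_neutral div_0 mult_zero_right singletonD)
    from insert.prems(3)[OF this] show "\<forall>j\<in>C. f j = 0"
      using insert.hyps by (force simp: ext_def split: if_splits)
  qed
  then obtain f where f: "\<forall>i\<in>R - {r}. (\<Sum>j\<in>C. A' i j * f j) = b i - A i s * b r / A r s" ..
  have "(\<Sum>j\<in>insert s C. A i j * ext (b r) f j) = b i" if "i \<in> R" for i
  proof (cases "i = r")
    case True
    then show ?thesis by (simp only: pivot)
  next
    case False
    with f that show ?thesis by (simp only: eliminated) simp
  qed
  then show ?case by blast
qed

section \<open>The torsion equation on an interval\<close>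

definition edge_profile :: "real \<Rightarrow> real \<Rightarrow> real \<Rightarrow> real \<Rightarrow> real" where
  "edge_profile L a b t = a * (1 - t / L) + b * t / L + t * (L - t) / 2"

lemma edge_profile_0: "edge_profile L a b 0 = a"
  by (simp add: edge_profile_def)

lemma edge_profile_end: "L \<noteq> 0 \<Longrightarrow> edge_profile L a b L = b"
  by (simp add: edge_profile_def)

lemma has_real_derivative_edge_profile:
  assumes "L \<noteq> 0"
  shows "(edge_profile L a b has_real_derivative ((b - a) / L + L / 2 - t)) (at t within S)"
  unfolding edge_profile_def[abs_def]
  using assms by (auto intro!: derivative_eq_intros simp: field_simps)

lemma edge_profile_nonneg:
  assumes "0 \<le> a" "0 \<le> b" "t \<in> {0..L}"
  shows "0 \<le> edge_profile L a b t"
proof -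
  have "t / L \<le> 1" using assms by (cases "L = 0") (auto simp: field_simps)
  then show ?thesis using assms unfolding edge_profile_def by auto
qed

text \<open>The affine part gives the trapezoid \<open>L * (a + b) / 2\<close>. The part
  \<open>t * (L - t) / 2\<close> gives \<open>L ^ 3 / 12\<close>, the torsional rigidity of an
  interval with Dirichlet ends and the source of the cubic term in the theorem.\<close>

lemma has_integral_edge_profile:
  assumes "L > 0"
  shows "(edge_profile L a b has_integral (L * (a + b) / 2 + L ^ 3 / 12)) {0..L}"
proof -
  define F where "F t = a * (t - t\<^sup>2 / (2 * L)) + b * t\<^sup>2 / (2 * L) + L * t\<^sup>2 / 4 - t ^ 3 / 6" for t
  have "(edge_profile L a b has_integral (F L - F 0)) {0..L}"
  proof (rule fundamental_theorem_of_calculus)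
    show "(F has_vector_derivative edge_profile L a b t) (at t within {0..L})" for t
      unfolding has_real_derivative_iff_has_vector_derivative[symmetric] F_def[abs_def] edge_profile_def
      using assms by (auto intro!: derivative_eq_intros simp: field_simps power2_eq_square)
  qed (use assms in simp)
  also have "F L - F 0 = L * (a + b) / 2 + L ^ 3 / 12"
    using assms by (simp add: F_def field_simps power2_eq_square power3_eq_cube)
  finally show ?thesis .
qed

text \<open>Two integrations: \<open>u' s + s\<close> and then
  \<open>u s - p * s + s\<^sup>2 / 2\<close> have zero derivative on the interval, so
  \<open>u\<close> is a quadratic with leading coefficient \<open>-1/2\<close>, and its end values
  fix the rest.\<close>

lemma edge_profile_unique:
  fixes u :: "real \<Rightarrow> real"
  assumes L: "L > 0"
    and diff: "\<And>t. t \<in> {0..L} \<Longrightarrow> u differentiable (at t within {0..L})"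
    and ode: "\<And>t. t \<in> {0..L} \<Longrightarrow>
      ((\<lambda>s. vector_derivative u (at s within {0..L})) has_real_derivative - 1) (at t within {0..L})"
    and t: "t \<in> {0..L}"
  shows "u t = edge_profile L (u 0) (u L) t"
proof -
  define u' where "u' s = vector_derivative u (at s within {0..L})" for s
  have u': "(u has_real_derivative u' s) (at s within {0..L})" if "s \<in> {0..L}" for s
    unfolding u'_def has_real_derivative_iff_has_vector_derivative
    using diff[OF that] by (simp add: vector_derivative_works)
  have "\<exists>p. \<forall>s\<in>{0..L}. u' s + s = p"
  proof (rule has_field_derivative_zero_constant)
    show "((\<lambda>s. u' s + s) has_field_derivative 0) (at s within {0..L})" if "s \<in> {0..L}" for s
      using ode[OF that] unfolding u'_def by (auto intro!: derivative_eq_intros)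
  qed simp
  then obtain p where p: "\<And>s. s \<in> {0..L} \<Longrightarrow> u' s = p - s" by (force simp: eq_diff_eq)
  have "\<exists>q. \<forall>s\<in>{0..L}. u s - p * s + s\<^sup>2 / 2 = q"
  proof (rule has_field_derivative_zero_constant)
    show "((\<lambda>s. u s - p * s + s\<^sup>2 / 2) has_field_derivative 0) (at s within {0..L})" if "s \<in> {0..L}" for s
      using u'[OF that] p[OF that] by (auto intro!: derivative_eq_intros)
  qed simp
  then obtain q where q: "\<And>s. s \<in> {0..L} \<Longrightarrow> u s = q + p * s - s\<^sup>2 / 2" by (force simp: field_simps)
  have ends: "u 0 = q" "u L = q + p * L - L\<^sup>2 / 2" using q[of 0] q[of L] L by auto
  show ?thesis
    unfolding ends q[OF t] edge_profile_def using L by (simp add: field_simps power2_eq_square)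
qed

section \<open>Potentials on the vertices\<close>

text \<open>The unnormalised graph Laplacian with conductances \<open>1 / l e\<close>. It sums over
  edge-ends, to match \<open>kirchhoff\<close>; a loop contributes \<open>0\<close> at each of its
  ends.\<close>

definition vertex_laplacian ::
    "('a, 'b) pre_digraph \<Rightarrow> ('b \<Rightarrow> real) \<Rightarrow> ('a \<Rightarrow> real) \<Rightarrow> 'a \<Rightarrow> real" where
  "vertex_laplacian G l U x =
     (\<Sum>e\<in>out_arcs G x. (U (head G e) - U x) / l e) + (\<Sum>e\<in>in_arcs G x. (U (tail G e) - U x) / l e)"

text \<open>Also a sum over edge-ends, so the length of a loop counts twice.\<close>

definition star_length :: "('a, 'b) pre_digraph \<Rightarrow> ('b \<Rightarrow> real) \<Rightarrow> 'a \<Rightarrow> real" where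
  "star_length G l x = (\<Sum>e\<in>out_arcs G x. l e) + (\<Sum>e\<in>in_arcs G x. l e)"

definition is_potential :: "('a, 'b) pre_digraph \<Rightarrow> ('b \<Rightarrow> real) \<Rightarrow> ('a \<Rightarrow> real) \<Rightarrow> bool" where
  "is_potential G l U \<longleftrightarrow>
     (\<forall>x\<in>dirichlet_verts G. U x = 0) \<and>
     (\<forall>x\<in>kirchhoff_verts G. vertex_laplacian G l U x = - star_length G l x / 2)"

text \<open>Both restrictions make the family extensional, as \<open>graph_functions\<close>
  demands.\<close>

definition profile_family ::
    "('a, 'b) pre_digraph \<Rightarrow> ('b \<Rightarrow> real) \<Rightarrow> ('a \<Rightarrow> real) \<Rightarrow> 'b \<Rightarrow> real \<Rightarrow> real" where
  "profile_family G l U =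
     (\<lambda>e\<in>arcs G. \<lambda>t\<in>{0..l e}. edge_profile (l e) (U (tail G e)) (U (head G e)) t)"

lemma vertex_laplacian_diff:
  "vertex_laplacian G l (\<lambda>y. U y - U' y) x = vertex_laplacian G l U x - vertex_laplacian G l U' x"
proof -
  have "((U y - U' y) - (U x - U' x)) / r = (U y - U x) / r - (U' y - U' x) / r" for y r
    by (simp add: diff_divide_distrib)
  then show ?thesis
    by (simp add: vertex_laplacian_def sum_subtractf)
qed

lemma vertex_laplacian_minus:
  "vertex_laplacian G l (\<lambda>y. - U y) x = - vertex_laplacian G l U x"
  using vertex_laplacian_diff[of G l "\<lambda>_. 0" U x] by (simp add: vertex_laplacian_def)

lemma vertex_laplacian_divide:
  "vertex_laplacian G l (\<lambda>y. U y / r) x = vertex_laplacian G l U x / r"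
proof -
  have "(U y / r - U x / r) / s = (U y - U x) / s / r" for y s
    by (simp add: diff_divide_distrib mult.commute)
  then show ?thesis
    by (simp add: vertex_laplacian_def sum_divide_distrib add_divide_distrib)
qed

lemma graph_functions_ext:
  assumes "u \<in> graph_functions G l" "v \<in> graph_functions G l"
    and "\<And>e t. e \<in> arcs G \<Longrightarrow> t \<in> {0..l e} \<Longrightarrow> u e t = v e t"
  shows "u = v"
  using assms(1,2) unfolding graph_functions_def
proof (rule PiE_ext)
  fix e assume e: "e \<in> arcs G"
  then have "u e \<in> {0..l e} \<rightarrow>\<^sub>E UNIV" "v e \<in> {0..l e} \<rightarrow>\<^sub>E UNIV"
    using assms(1,2) unfolding graph_functions_def by (auto dest: PiE_mem)
  then show "u e = v e" by (rule PiE_ext) (use assms(3) e in blast)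
qed

context quantum_graph
begin

section \<open>Minimum principle and uniqueness of potentials\<close>

lemma verts_eq_dirichlet_Un_kirchhoff: "verts G = dirichlet_verts G \<union> kirchhoff_verts G"
  by (auto simp: dirichlet_verts_def kirchhoff_verts_def)

text \<open>Connectedness in the form that the minimum principle needs. It means reachability in the
  symmetrised digraph, where a walk may run against arcs; hence the equivalence in
  \<open>closed\<close>, which carries membership along the walk.\<close>

lemma closed_set_eq_verts:
  assumes "M \<subseteq> verts G" "M \<noteq> {}"
    and closed: "\<And>e. e \<in> arcs G \<Longrightarrow> tail G e \<in> M \<longleftrightarrow> head G e \<in> M"
  shows "M = verts G"
proof -
  interpret S: pair_wf_digraph "mk_symmetric G" ..
  obtain u where u: "u \<in> M" using assms(2) by blast
  have "v \<in> M" if "v \<in> verts G" for v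
  proof -
    have "u \<rightarrow>\<^sup>*\<^bsub>with_proj (mk_symmetric G)\<^esub> v"
      using connected_graph u that assms(1)
      unfolding Digraph_Component.connected_def strongly_connected_def by auto
    then show ?thesis
    proof (induction rule: S.reachable_induct)
      case (step x y)
      then show ?case using closed by (auto simp: parcs_mk_symmetric)
    qed (use u in simp)
  qed
  with assms(1) show ?thesis by blast
qed

text \<open>Suppose the minimum \<open>m\<close> is negative. At a vertex attaining it, all
  differences to neighbours are nonnegative while their weighted sum is at most \<open>0\<close>, so
  they vanish. The set \<open>M\<close> of minimisers is thus closed under adjacency and contains
  every vertex, including a Dirichlet vertex, where \<open>U\<close> is nonnegative.\<close>

lemma vertex_laplacian_minimum_principle:
  assumes D: "dirichlet_verts G \<noteq> {}"
    and boundary: "\<And>x. x \<in> dirichlet_verts G \<Longrightarrow> 0 \<le> U x"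
    and superharmonic: "\<And>x. x \<in> kirchhoff_verts G \<Longrightarrow> vertex_laplacian G l U x \<le> 0"
    and x: "x \<in> verts G"
  shows "0 \<le> U x"
proof (rule ccontr)
  assume neg: "\<not> 0 \<le> U x"
  define m where "m = Min (U ` verts G)"
  have m: "m \<le> U y" if "y \<in> verts G" for y
    using that finite_verts unfolding m_def by simp
  define M where "M = {y \<in> verts G. U y = m}"
  have "m \<in> U ` verts G" unfolding m_def using finite_verts x by (intro Min_in) auto
  then have "M \<noteq> {}" by (auto simp: M_def)
  have step: "(\<forall>e\<in>out_arcs G y. head G e \<in> M) \<and> (\<forall>e\<in>in_arcs G y. tail G e \<in> M)" if "y \<in> M" for y
  proof -
    have y: "y \<in> verts G" "U y = m" using that by (auto simp: M_def)
    \<comment> \<open>On Dirichlet vertices \<open>U\<close> is nonnegative, whereas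
      \<open>m \<le> U x < 0\<close>.\<close>
    then have "y \<in> kirchhoff_verts G"
      using boundary[of y] neg m[OF x] verts_eq_dirichlet_Un_kirchhoff by fastforce
    from superharmonic[OF this]
    have le: "(\<Sum>e\<in>out_arcs G y. (U (head G e) - m) / l e) + (\<Sum>e\<in>in_arcs G y. (U (tail G e) - m) / l e) \<le> 0"
      by (simp add: vertex_laplacian_def y)
    have out: "0 \<le> (U (head G e) - m) / l e" if "e \<in> out_arcs G y" for e
      using that length_pos[of e] m[of "head G e"] by auto
    have "in": "0 \<le> (U (tail G e) - m) / l e" if "e \<in> in_arcs G y" for e
      using that length_pos[of e] m[of "tail G e"] by auto
    have "0 \<le> (\<Sum>e\<in>out_arcs G y. (U (head G e) - m) / l e)" "0 \<le> (\<Sum>e\<in>in_arcs G y. (U (tail G e) - m) / l e)"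
      using out "in" by (auto intro: sum_nonneg)
    with le have sum0: "(\<Sum>e\<in>out_arcs G y. (U (head G e) - m) / l e) = 0"
        "(\<Sum>e\<in>in_arcs G y. (U (tail G e) - m) / l e) = 0"
      by linarith+
    have "(U (head G e) - m) / l e = 0" if "e \<in> out_arcs G y" for e
      by (rule sum_nonneg_0[OF finite_out_arcs _ sum0(1) that]) (rule out)
    moreover have "(U (tail G e) - m) / l e = 0" if "e \<in> in_arcs G y" for e
      by (rule sum_nonneg_0[OF finite_in_arcs _ sum0(2) that]) (rule "in")
    ultimately show ?thesis using length_pos by (fastforce simp: M_def)
  qed
  have "M = verts G"
  proof (rule closed_set_eq_verts)
    show "M \<subseteq> verts G" by (auto simp: M_def)
    show "tail G e \<in> M \<longleftrightarrow> head G e \<in> M" if "e \<in> arcs G" for e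
      using step that by (meson in_in_arcs_conv in_out_arcs_conv)
  qed fact
  obtain z where z: "z \<in> dirichlet_verts G" using D by blast
  then have "U z = m" using \<open>M = verts G\<close> by (auto simp: M_def dirichlet_verts_def)
  then show False using boundary[OF z] m[OF x] neg by simp
qed

text \<open>The minimum principle applied to \<open>U\<close> and to \<open>- U\<close>. This yields
  uniqueness of potentials and also the trivial kernel behind their existence.\<close>

lemma harmonic_eq_0:
  assumes "dirichlet_verts G \<noteq> {}"
    and "\<And>x. x \<in> dirichlet_verts G \<Longrightarrow> U x = 0"
    and "\<And>x. x \<in> kirchhoff_verts G \<Longrightarrow> vertex_laplacian G l U x = 0"
    and "x \<in> verts G"
  shows "U x = 0"
proof -
  have "0 \<le> U x"
    using assms by (intro vertex_laplacian_minimum_principle[of U x]) simp_all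
  moreover have "0 \<le> - U x"
    using assms by (intro vertex_laplacian_minimum_principle[of "\<lambda>y. - U y" x])
      (simp_all add: vertex_laplacian_minus)
  ultimately show ?thesis by simp
qed

lemma is_potential_unique:
  assumes "dirichlet_verts G \<noteq> {}" "is_potential G l U" "is_potential G l U'" "x \<in> verts G"
  shows "U x = U' x"
  using harmonic_eq_0[of "\<lambda>x. U x - U' x" x] assms
  by (auto simp: is_potential_def vertex_laplacian_diff)

section \<open>Existence of a potential\<close>

lemma sum_of_bool_eq_mult:
  assumes "z \<in> verts G"
  shows "(\<Sum>y\<in>verts G. of_bool (z = y) * U y) = (U z :: real)"
proof -
  have "(\<Sum>y\<in>verts G. of_bool (z = y) * U y) = (\<Sum>y\<in>verts G. if z = y then U y else 0)"
    by (intro sum.cong) auto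
  with assms show ?thesis by simp
qed

text \<open>Puts the Laplacian into matrix form, with the images of the indicator functions as
  columns, so that \<open>linear_system_solvable\<close> applies.\<close>

lemma vertex_laplacian_expand:
  assumes "x \<in> verts G"
  shows "vertex_laplacian G l U x = (\<Sum>y\<in>verts G. vertex_laplacian G l (\<lambda>z. of_bool (z = y)) x * U y)"
proof -
  have quotient: "(\<Sum>y\<in>verts G. (of_bool (z = y) - of_bool (x = y)) / r * U y) = (U z - U x) / r"
    if "z \<in> verts G" for z r
    using that assms
    by (simp add: left_diff_distrib sum_subtractf sum_of_bool_eq_mult flip: sum_divide_distrib)
  have "(\<Sum>y\<in>verts G. vertex_laplacian G l (\<lambda>z. of_bool (z = y)) x * U y) =
    (\<Sum>e\<in>out_arcs G x. \<Sum>y\<in>verts G. (of_bool (head G e = y) - of_bool (x = y)) / l e * U y) +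
    (\<Sum>e\<in>in_arcs G x. \<Sum>y\<in>verts G. (of_bool (tail G e = y) - of_bool (x = y)) / l e * U y)"
    unfolding vertex_laplacian_def distrib_right sum_distrib_right sum.distrib
    by (intro arg_cong2[of _ _ _ _ "(+)"] sum.swap)
  also have "\<dots> = vertex_laplacian G l U x"
    unfolding vertex_laplacian_def
    by (intro arg_cong2[of _ _ _ _ "(+)"] sum.cong refl quotient) auto
  finally show ?thesis by simp
qed

lemma ex_potential:
  assumes "dirichlet_verts G \<noteq> {}"
  shows "\<exists>U. is_potential G l U"
proof -
  \<comment> \<open>Dirichlet conditions enter as identity rows, which keeps the system square: rows
    and columns are both indexed by \<open>verts G\<close>.\<close>
  define A where "A x y = (if x \<in> dirichlet_verts G then of_bool (x = y)
      else vertex_laplacian G l (\<lambda>z. of_bool (z = y)) x)" for x y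
  have A: "(\<Sum>y\<in>verts G. A x y * U y) =
      (if x \<in> dirichlet_verts G then U x else vertex_laplacian G l U x)" if "x \<in> verts G" for x U
    using that vertex_laplacian_expand[OF that, of U]
    by (cases "x \<in> dirichlet_verts G") (simp_all only: A_def if_True if_False sum_of_bool_eq_mult)
  have "\<exists>U. \<forall>x\<in>verts G. (\<Sum>y\<in>verts G. A x y * U y) =
      (if x \<in> dirichlet_verts G then 0 else - star_length G l x / 2)"
  proof (rule linear_system_solvable)
    fix U assume "\<And>x. x \<in> verts G \<Longrightarrow> (\<Sum>y\<in>verts G. A x y * U y) = 0"
    then have "\<And>x. x \<in> verts G \<Longrightarrow> (if x \<in> dirichlet_verts G then U x else vertex_laplacian G l U x) = 0"
      using A by simp
    then have "U x = 0" if "x \<in> verts G" for x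
      using that assms
      by (intro harmonic_eq_0[of U x]) (force simp: dirichlet_verts_def kirchhoff_verts_def split: if_splits)+
    then show "\<forall>x\<in>verts G. U x = 0" by blast
  qed (simp_all add: finite_verts)
  then obtain U where U: "\<And>x. x \<in> verts G \<Longrightarrow> (\<Sum>y\<in>verts G. A x y * U y) =
      (if x \<in> dirichlet_verts G then 0 else - star_length G l x / 2)" by blast
  have "is_potential G l U"
    unfolding is_potential_def
  proof (intro conjI ballI)
    show "U x = 0" if "x \<in> dirichlet_verts G" for x
      using that A[of x U] U[of x] by (simp add: verts_eq_dirichlet_Un_kirchhoff)
    show "vertex_laplacian G l U x = - star_length G l x / 2" if "x \<in> kirchhoff_verts G" for x
      using that A[of x U] U[of x] by (simp add: kirchhoff_verts_def)
  qed
  then show ?thesis by blast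
qed

section \<open>Sign and weighted sum of a potential\<close>

lemma star_length_nonneg: "0 \<le> star_length G l x"
  unfolding star_length_def by (intro add_nonneg_nonneg sum_nonneg) (auto intro: less_imp_le length_pos)

text \<open>The right-hand side \<open>- star_length G l x / 2\<close> makes \<open>U\<close>
  superharmonic. Together with \<open>edge_profile_nonneg\<close> this later removes the absolute
  value in the quantum torsional rigidity.\<close>

lemma potential_nonneg:
  assumes "dirichlet_verts G \<noteq> {}" "is_potential G l U" "x \<in> verts G"
  shows "0 \<le> U x"
  using assms star_length_nonneg
  by (intro vertex_laplacian_minimum_principle[of U x]) (auto simp: is_potential_def)

text \<open>Double counting: each arc contributes its length once at its tail and once at its
  head.\<close>

lemma sum_mult_star_length:
  "(\<Sum>x\<in>verts G. U x * star_length G l x) = (\<Sum>e\<in>arcs G. l e * (U (tail G e) + U (head G e)))"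
proof -
  have "(\<Sum>x\<in>verts G. U x * star_length G l x) =
      (\<Sum>x\<in>verts G. \<Sum>e | e \<in> arcs G \<and> tail G e = x. l e * U (tail G e)) +
      (\<Sum>x\<in>verts G. \<Sum>e | e \<in> arcs G \<and> head G e = x. l e * U (head G e))"
    unfolding star_length_def out_arcs_def in_arcs_def sum.distrib[symmetric]
    by (auto simp: distrib_left sum_distrib_left mult.commute intro!: sum.cong)
  also have "\<dots> = (\<Sum>e\<in>arcs G. l e * U (tail G e)) + (\<Sum>e\<in>arcs G. l e * U (head G e))"
    by (intro arg_cong2[of _ _ _ _ "(+)"] sum.group) auto
  finally show ?thesis by (simp add: distrib_left sum.distrib)
qed

section \<open>The quantum torsion function\<close>

lemma profile_family_apply:
  "e \<in> arcs G \<Longrightarrow> t \<in> {0..l e} \<Longrightarrow>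
     profile_family G l U e t = edge_profile (l e) (U (tail G e)) (U (head G e)) t"
  by (simp add: profile_family_def)

lemma has_vector_derivative_profile_family:
  assumes "e \<in> arcs G" "t \<in> {0..l e}"
  shows "(profile_family G l U e has_vector_derivative
    ((U (head G e) - U (tail G e)) / l e + l e / 2 - t)) (at t within {0..l e})"
proof (rule has_vector_derivative_transform[OF assms(2)])
  show "(edge_profile (l e) (U (tail G e)) (U (head G e)) has_vector_derivative
      ((U (head G e) - U (tail G e)) / l e + l e / 2 - t)) (at t within {0..l e})"
    using has_real_derivative_edge_profile length_pos[OF assms(1)]
    by (simp add: has_real_derivative_iff_has_vector_derivative)
qed (use assms in \<open>simp add: profile_family_apply\<close>)

lemma edge_deriv_profile_family:
  assumes "e \<in> arcs G" "t \<in> {0..l e}"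
  shows "edge_deriv l (profile_family G l U) e t = (U (head G e) - U (tail G e)) / l e + l e / 2 - t"
  unfolding edge_deriv_def
  using vector_derivative_within_closed_interval[OF length_pos[OF assms(1)] assms(2)
    has_vector_derivative_profile_family[OF assms]] .

text \<open>Each edge-end has outgoing derivative (far value - near value) / length + length / 2. At
  the head this arises from negating \<open>l e / 2 - l e\<close>.\<close>

lemma kirchhoff_profile_family:
  "kirchhoff G l (profile_family G l U) x \<longleftrightarrow> vertex_laplacian G l U x = - star_length G l x / 2"
proof -
  have "(\<Sum>e\<in>out_arcs G x. edge_deriv l (profile_family G l U) e 0) =
      (\<Sum>e\<in>out_arcs G x. (U (head G e) - U x) / l e + l e / 2)"
    by (intro sum.cong) (auto simp: edge_deriv_profile_family less_imp_le[OF length_pos])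
  moreover have "(\<Sum>e\<in>in_arcs G x. - edge_deriv l (profile_family G l U) e (l e)) =
      (\<Sum>e\<in>in_arcs G x. (U (tail G e) - U x) / l e + l e / 2)"
    by (intro sum.cong) (auto simp: edge_deriv_profile_family less_imp_le[OF length_pos] diff_divide_distrib)
  ultimately show ?thesis
    unfolding kirchhoff_def vertex_laplacian_def star_length_def
    by (simp only: sum.distrib flip: sum_divide_distrib) (simp add: add_divide_distrib, linarith)
qed

text \<open>Reduces the boundary value problem to the linear system for vertex values:
  \<open>edge_profile_unique\<close> fixes \<open>v\<close> on each edge, and
  \<open>kirchhoff_profile_family\<close> translates the vertex condition.\<close>

lemma is_torsion_function_iff:
  "is_torsion_function G l v \<longleftrightarrow> (\<exists>U. is_potential G l U \<and> v = profile_family G l U)"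
proof
  assume v: "is_torsion_function G l v"
  then obtain U where U: "continuous_on_graph G l v U" "\<forall>x\<in>dirichlet_verts G. U x = 0"
    by (auto simp: is_torsion_function_def)
  have "v e t = profile_family G l U e t" if e: "e \<in> arcs G" and t: "t \<in> {0..l e}" for e t
  proof -
    have "v e t = edge_profile (l e) (v e 0) (v e (l e)) t"
    proof (rule edge_profile_unique[OF length_pos[OF e] _ _ t])
      fix s assume s: "s \<in> {0..l e}"
      with v e show "v e differentiable (at s within {0..l e})"
        unfolding is_torsion_function_def by blast
      from v e s have "(edge_deriv l v e has_real_derivative - 1) (at s within {0..l e})"
        unfolding is_torsion_function_def by blast
      then show "((\<lambda>r. vector_derivative (v e) (at r within {0..l e})) has_real_derivative - 1) (at s within {0..l e})"
        by (simp add: edge_deriv_def[abs_def])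
    qed
    with U(1) e t show ?thesis by (simp add: profile_family_apply continuous_on_graph_def)
  qed
  moreover have "v \<in> graph_functions G l" "profile_family G l U \<in> graph_functions G l"
    using v by (auto simp: is_torsion_function_def profile_family_def graph_functions_def)
  ultimately have eq: "v = profile_family G l U"
    by (intro graph_functions_ext)
  with v U(2) have "is_potential G l U"
    by (simp add: is_torsion_function_def is_potential_def kirchhoff_profile_family)
  with eq show "\<exists>U. is_potential G l U \<and> v = profile_family G l U" by blast
next
  assume "\<exists>U. is_potential G l U \<and> v = profile_family G l U"
  then obtain U where U: "is_potential G l U" and v: "v = profile_family G l U" by blast
  have "continuous_on_graph G l v U"
    unfolding continuous_on_graph_def v
    using length_pos
    by (auto simp: profile_family_apply edge_profile_0 edge_profile_end less_imp_le less_imp_neq[THEN not_sym]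
        intro!: continuous_on_vector_derivative has_vector_derivative_profile_family)
  moreover have "(edge_deriv l v e has_real_derivative - 1) (at t within {0..l e})"
    if "e \<in> arcs G" "t \<in> {0..l e}" for e t
  proof (rule has_field_derivative_transform_within[OF _ zero_less_one that(2)])
    show "((\<lambda>t. (U (head G e) - U (tail G e)) / l e + l e / 2 - t) has_real_derivative - 1) (at t within {0..l e})"
      by (auto intro!: derivative_eq_intros)
  qed (use that in \<open>simp add: v edge_deriv_profile_family\<close>)
  moreover have "v e differentiable (at t within {0..l e})" if "e \<in> arcs G" "t \<in> {0..l e}" for e t
    using has_vector_derivative_profile_family[OF that] unfolding v by (rule differentiableI_vector)
  moreover have "v \<in> graph_functions G l"
    by (auto simp: v profile_family_def graph_functions_def)
  ultimately show "is_torsion_function G l v"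
    using U by (auto simp: is_torsion_function_def is_potential_def v kirchhoff_profile_family)
qed

text \<open>Two potentials agree on \<open>verts G\<close>, and \<open>profile_family\<close> sees
  only those values, so the definite description is well defined.\<close>

lemma torsion_function_eq:
  assumes "dirichlet_verts G \<noteq> {}" "is_potential G l U"
  shows "torsion_function G l = profile_family G l U"
  unfolding torsion_function_def
proof (rule the_equality)
  show "is_torsion_function G l (profile_family G l U)"
    using assms by (auto simp: is_torsion_function_iff)
  fix v assume "is_torsion_function G l v"
  then obtain U' where "is_potential G l U'" "v = profile_family G l U'"
    by (auto simp: is_torsion_function_iff)
  then show "v = profile_family G l U"
    using is_potential_unique[OF assms(1) _ assms(2)]
    by (auto simp: profile_family_def fun_eq_iff)
qed

lemma quantum_torsional_rigidity_eq:
  assumes "dirichlet_verts G \<noteq> {}" "is_potential G l U"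
  shows "quantum_torsional_rigidity G l =
    1 / 12 * (\<Sum>e\<in>arcs G. l e ^ 3) + 1 / 2 * (\<Sum>x\<in>verts G. U x * star_length G l x)"
proof -
  have "integral {0..l e} (\<lambda>t. \<bar>torsion_function G l e t\<bar>) =
      l e * (U (tail G e) + U (head G e)) / 2 + l e ^ 3 / 12" if e: "e \<in> arcs G" for e
  proof -
    have "integral {0..l e} (\<lambda>t. \<bar>torsion_function G l e t\<bar>) =
        integral {0..l e} (edge_profile (l e) (U (tail G e)) (U (head G e)))"
      using e potential_nonneg[OF assms]
      by (intro integral_cong) (simp add: torsion_function_eq[OF assms] profile_family_apply edge_profile_nonneg)
    then show ?thesis
      using has_integral_edge_profile[OF length_pos[OF e]] by (simp add: integral_unique)
  qed
  then show ?thesis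
    by (simp add: quantum_torsional_rigidity_def graph_integral_def sum_mult_star_length sum.distrib
        flip: sum_divide_distrib)
qed

section \<open>The weighted discrete graph\<close>

lemma edge_length_commute: "edge_length G l x y = edge_length G l y x"
proof -
  have "joins G e x y \<longleftrightarrow> joins G e y x" for e
    unfolding joins_def by (simp only: insert_commute)
  then show ?thesis by (simp only: edge_length_def adj_def)
qed

section \<open>Edge-end sums as vertex sums, in the absence of multiple edges\<close>

context
  assumes no_mult: "no_multiple_edges G"
begin

text \<open>Justifies the definite description in \<open>edge_length\<close>; the set form also
  covers non-adjacent pairs, so sums over joining arcs collapse uniformly.\<close>

lemma Collect_joins:
  "{e. joins G e x y} = (if adj G x y then {THE e. joins G e x y} else {})"
proof (cases "adj G x y")
  case True
  then obtain e where e: "joins G e x y" by (auto simp: adj_def)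
  then have unique: "e' = e" if "joins G e' x y" for e'
    using that no_mult by (auto simp: joins_def no_multiple_edges_def)
  with e have "(THE e. joins G e x y) = e" by blast
  moreover have "{e. joins G e x y} = {e}" using e unique by blast
  ultimately show ?thesis using True by (simp only: if_True)
qed (auto simp: adj_def)

lemma edge_length_pos: "adj G x y \<Longrightarrow> 0 < edge_length G l x y"
  using Collect_joins[of x y] by (auto simp: edge_length_def joins_def intro!: length_pos)

lemma edge_length_nonneg: "0 \<le> edge_length G l x y"
  using edge_length_pos[of x y] by (cases "adj G x y") (auto simp: edge_length_def)

text \<open>Group edge-ends by the vertex \<open>y\<close> at the other end. For
  \<open>y \<noteq> x\<close> a joining arc occurs in exactly one of the two sums, whereas a loop
  occurs in both, which produces the extra \<open>g x\<close>.\<close>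

lemma sum_edge_ends:
  fixes F :: "'b \<Rightarrow> 'a \<Rightarrow> real"
  assumes x: "x \<in> verts G"
  defines "g \<equiv> \<lambda>y. if adj G x y then F (THE e. joins G e x y) y else 0"
  shows "(\<Sum>e\<in>out_arcs G x. F e (head G e)) + (\<Sum>e\<in>in_arcs G x. F e (tail G e)) =
    (\<Sum>y\<in>verts G. g y) + g x"
proof -
  have g: "g y = (\<Sum>e | joins G e x y. F e y)" for y
    by (simp add: g_def Collect_joins)
  have out: "(\<Sum>e\<in>out_arcs G x. F e (head G e)) =
      (\<Sum>y\<in>verts G. \<Sum>e | e \<in> out_arcs G x \<and> head G e = y. F e y)"
    by (subst sum.group[symmetric, where g = "head G" and T = "verts G"]) auto
  have "in": "(\<Sum>e\<in>in_arcs G x. F e (tail G e)) =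
      (\<Sum>y\<in>verts G. \<Sum>e | e \<in> in_arcs G x \<and> tail G e = y. F e y)"
    by (subst sum.group[symmetric, where g = "tail G" and T = "verts G"]) auto
  have "(\<Sum>e | e \<in> out_arcs G x \<and> head G e = y. F e y) + (\<Sum>e | e \<in> in_arcs G x \<and> tail G e = y. F e y) =
      g y + (if y = x then g x else 0)" for y
  proof (cases "y = x")
    case True
    have "{e. e \<in> out_arcs G x \<and> head G e = x} = {e. joins G e x x}"
      "{e. e \<in> in_arcs G x \<and> tail G e = x} = {e. joins G e x x}"
      by (auto simp: joins_def)
    then show ?thesis by (simp add: True g)
  next
    case False
    have "{e. joins G e x y} =
        {e. e \<in> out_arcs G x \<and> head G e = y} \<union> {e. e \<in> in_arcs G x \<and> tail G e = y}"
      by (auto simp: joins_def doubleton_eq_iff)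
    moreover have "{e. e \<in> out_arcs G x \<and> head G e = y} \<inter> {e. e \<in> in_arcs G x \<and> tail G e = y} = {}"
      using False by auto
    ultimately show ?thesis
      using False by (simp add: g sum.union_disjoint)
  qed
  then show ?thesis
    unfolding out "in" sum.distrib[symmetric] using x finite_verts by (simp add: sum.distrib)
qed

lemma star_length_eq:
  "x \<in> verts G \<Longrightarrow> star_length G l x = (\<Sum>y\<in>verts G. edge_length G l x y) + edge_length G l x x"
  using sum_edge_ends[of x "\<lambda>e _. l e"] by (simp add: star_length_def edge_length_def[abs_def])

text \<open>Non-adjacent \<open>y\<close> contribute nothing here and below, as then \<open>edge_length G l x y = 0\<close> and
  division by \<open>0\<close> gives \<open>0\<close>.\<close>

lemma vertex_laplacian_eq:
  assumes "x \<in> verts G"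
  shows "vertex_laplacian G l U x = (\<Sum>y\<in>verts G. (U y - U x) / edge_length G l x y)"
proof -
  have "(if adj G x y then (U y - U x) / l (THE e. joins G e x y) else 0) =
      (U y - U x) / edge_length G l x y" for y
    by (simp add: edge_length_def)
  \<comment> \<open>The extra loop term from \<open>sum_edge_ends\<close> has numerator
    \<open>U x - U x = 0\<close>.\<close>
  then show ?thesis
    using sum_edge_ends[OF assms, of "\<lambda>e y. (U y - U x) / l e"] by (simp add: vertex_laplacian_def)
qed

lemma loop_excess_eq:
  assumes "x \<in> verts G"
  shows "loop_excess G l c x =
    c * (\<Sum>y\<in>verts G. edge_length G l x y) - (\<Sum>y\<in>verts G. 1 / (c * edge_length G l x y))"
proof -
  have zero: "edge_length G l y x = 0" if "y \<in> verts G - nbrs G x" for y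
    using that by (auto simp: nbrs_def edge_length_def)
  have sub: "nbrs G x \<subseteq> verts G" by (auto simp: nbrs_def)
  have "(\<Sum>y\<in>nbrs G x. c * edge_length G l y x) = (\<Sum>y\<in>verts G. c * edge_length G l y x)"
    "(\<Sum>y\<in>nbrs G x. 1 / (c * edge_length G l y x)) = (\<Sum>y\<in>verts G. 1 / (c * edge_length G l y x))"
    by (intro sum.mono_neutral_left finite_verts sub; simp add: zero)+
  then show ?thesis
    unfolding loop_excess_def by (simp add: edge_length_commute[of _ x] sum_distrib_left)
qed

section \<open>Torsion of the random walk on the weighted graph\<close>

lemma discrete_weight_eq:
  assumes "x \<in> kirchhoff_verts G"
  shows "discrete_weight G l c x y = 1 / (c * edge_length G l x y) +
    (if y = x then c * edge_length G l x x + loop_excess G l c x else 0)"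
  using assms by (auto simp: discrete_weight_def edge_length_def)

text \<open>The reciprocal lengths in the weights cancel those subtracted in
  \<open>loop_excess\<close>. The separate summand \<open>c * edge_length G l x x\<close> supplies
  the second end of a loop, as counted by \<open>star_length\<close>.\<close>

lemma weighted_degree_eq:
  assumes "x \<in> kirchhoff_verts G"
  shows "weighted_degree (verts G) (discrete_weight G l c) x = c * star_length G l x"
proof -
  have x: "x \<in> verts G" using assms by (simp add: kirchhoff_verts_def)
  then show ?thesis
    using finite_verts
    by (simp add: weighted_degree_def discrete_weight_eq[OF assms] sum.distrib loop_excess_eq
        star_length_eq distrib_left)
qed

text \<open>The diagonal weight multiplies \<open>f x - f x = 0\<close>, so the loop terms affect
  only the weighted degree.\<close>

lemma sum_discrete_weight_diff:
  assumes "x \<in> kirchhoff_verts G"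
  shows "(\<Sum>y\<in>verts G. discrete_weight G l c x y * (f y - f x)) = vertex_laplacian G l f x / c"
proof -
  have "(\<Sum>y\<in>verts G. discrete_weight G l c x y * (f y - f x)) =
      (\<Sum>y\<in>verts G. (f y - f x) / edge_length G l x y / c)"
    by (intro sum.cong) (auto simp: discrete_weight_eq[OF assms] mult.commute)
  moreover have "x \<in> verts G" using assms by (simp add: kirchhoff_verts_def)
  ultimately show ?thesis by (simp add: vertex_laplacian_eq sum_divide_distrib)
qed

text \<open>Ensures that the weighted degree is nonzero, so that the denominator of
  \<open>rw_laplacian\<close> can be cleared.\<close>

lemma star_length_pos:
  assumes "c > 0" "x \<in> kirchhoff_verts G" "loop_excess G l c x > 0"
  shows "0 < star_length G l x"
proof -
  have x: "x \<in> verts G" using assms by (simp add: kirchhoff_verts_def)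
  have "0 \<le> (\<Sum>y\<in>verts G. 1 / (c * edge_length G l x y))"
    using \<open>c > 0\<close> edge_length_nonneg by (auto intro!: sum_nonneg)
  with assms(3) have "0 < c * (\<Sum>y\<in>verts G. edge_length G l x y)"
    by (simp add: loop_excess_eq[OF x])
  with \<open>c > 0\<close> have "0 < (\<Sum>y\<in>verts G. edge_length G l x y)"
    by (simp add: zero_less_mult_iff)
  with edge_length_nonneg[of x x] show ?thesis by (simp add: star_length_eq[OF x])
qed

text \<open>With weighted degree \<open>c * star_length G l x\<close> and weighted difference sum
  \<open>vertex_laplacian G l f x / c\<close>, the torsion equation says that the Laplacian of
  \<open>f\<close> is \<open>- c\<^sup>2 * star_length G l x\<close>. Dividing by
  \<open>2 * c\<^sup>2\<close> gives the equation of a potential.\<close>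

lemma is_rw_torsion_function_iff:
  assumes c: "c > 0" and excess: "\<And>x. x \<in> kirchhoff_verts G \<Longrightarrow> loop_excess G l c x > 0"
  shows "is_rw_torsion_function (verts G) (discrete_weight G l c) (kirchhoff_verts G) f \<longleftrightarrow>
    f \<in> verts G \<rightarrow>\<^sub>E UNIV \<and> is_potential G l (\<lambda>x. f x / (2 * c\<^sup>2))"
proof -
  have "- rw_laplacian (verts G) (discrete_weight G l c) f x = 1 \<longleftrightarrow>
      vertex_laplacian G l (\<lambda>x. f x / (2 * c\<^sup>2)) x = - star_length G l x / 2"
    if x: "x \<in> kirchhoff_verts G" for x
    unfolding rw_laplacian_def weighted_degree_eq[OF x] sum_discrete_weight_diff[OF x] vertex_laplacian_divide
    using c star_length_pos[OF c x excess[OF x]]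
    by (auto simp: field_simps power2_eq_square)
  moreover have "verts G - kirchhoff_verts G = dirichlet_verts G"
    by (auto simp: kirchhoff_verts_def dirichlet_verts_def)
  ultimately show ?thesis
    using c by (auto simp: is_rw_torsion_function_def is_potential_def)
qed

lemma rw_torsion_function_eq:
  assumes D: "dirichlet_verts G \<noteq> {}" and U: "is_potential G l U"
    and c: "c > 0" and excess: "\<And>x. x \<in> kirchhoff_verts G \<Longrightarrow> loop_excess G l c x > 0"
    and x: "x \<in> verts G"
  shows "rw_torsion_function (verts G) (discrete_weight G l c) (kirchhoff_verts G) x = 2 * c\<^sup>2 * U x"
proof -
  let ?P = "is_rw_torsion_function (verts G) (discrete_weight G l c) (kirchhoff_verts G)"
  \<comment> \<open>Restricted to \<open>verts G\<close>, since
    \<open>is_rw_torsion_function\<close> asks for an extensional function.\<close>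
  define f where "f = (\<lambda>x\<in>verts G. 2 * c\<^sup>2 * U x)"
  have "vertex_laplacian G l (\<lambda>x. f x / (2 * c\<^sup>2)) y = vertex_laplacian G l U y" if "y \<in> verts G" for y
    unfolding vertex_laplacian_def
    using c that by (intro arg_cong2[of _ _ _ _ "(+)"] sum.cong) (auto simp: f_def)
  with U c have "is_potential G l (\<lambda>x. f x / (2 * c\<^sup>2))"
    by (auto simp: is_potential_def kirchhoff_verts_def dirichlet_verts_def f_def)
  then have "?P f"
    by (simp add: is_rw_torsion_function_iff[OF c excess] f_def)
  moreover have "f' = f" if "?P f'" for f'
  proof (rule PiE_ext)
    show "f' \<in> verts G \<rightarrow>\<^sub>E UNIV" "f \<in> verts G \<rightarrow>\<^sub>E UNIV"
      using that \<open>?P f\<close> by (auto simp: is_rw_torsion_function_iff[OF c excess])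
    fix y assume "y \<in> verts G"
    then show "f' y = f y"
      using that U c is_potential_unique[OF D, of "\<lambda>x. f' x / (2 * c\<^sup>2)" U y]
      by (simp add: is_rw_torsion_function_iff[OF c excess] f_def field_simps)
  qed
  ultimately have "(THE f. ?P f) = f" by blast
  with x show ?thesis by (simp add: rw_torsion_function_def f_def)
qed

lemma rw_torsional_rigidity_eq:
  assumes D: "dirichlet_verts G \<noteq> {}" and U: "is_potential G l U"
    and c: "c > 0" and excess: "\<And>x. x \<in> kirchhoff_verts G \<Longrightarrow> loop_excess G l c x > 0"
  shows "rw_torsional_rigidity (verts G) (discrete_weight G l c) (kirchhoff_verts G) =
    2 * c ^ 3 * (\<Sum>x\<in>verts G. U x * star_length G l x)"
proof -
  have "rw_torsional_rigidity (verts G) (discrete_weight G l c) (kirchhoff_verts G) =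
      (\<Sum>x\<in>kirchhoff_verts G. 2 * c ^ 3 * (U x * star_length G l x))"
    unfolding rw_torsional_rigidity_def
  proof (intro sum.cong refl)
    fix x assume x: "x \<in> kirchhoff_verts G"
    then have "x \<in> verts G" by (simp add: kirchhoff_verts_def)
    then show "weighted_degree (verts G) (discrete_weight G l c) x *
        rw_torsion_function (verts G) (discrete_weight G l c) (kirchhoff_verts G) x =
        2 * c ^ 3 * (U x * star_length G l x)"
      unfolding weighted_degree_eq[OF x]
      by (simp add: rw_torsion_function_eq[OF assms] power2_eq_square power3_eq_cube)
  qed
  \<comment> \<open>The added terms vanish because \<open>U\<close> is \<open>0\<close> on Dirichlet
    vertices.\<close>
  also have "\<dots> = (\<Sum>x\<in>verts G. 2 * c ^ 3 * (U x * star_length G l x))"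
    using U by (intro sum.mono_neutral_left finite_verts) (auto simp: kirchhoff_verts_def is_potential_def)
  finally show ?thesis by (simp add: sum_distrib_left)
qed

end

end

theorem theorem7p1:
  fixes G :: "('a, 'b) pre_digraph" and l :: "'b \<Rightarrow> real" and c :: real
  assumes "quantum_graph G l"
    and "no_multiple_edges G"
    and "dirichlet_verts G \<noteq> {}"
    and "kirchhoff_verts G \<noteq> {}"
    and "c > 0"
    and "\<And>x. x \<in> kirchhoff_verts G \<Longrightarrow> loop_excess G l c x > 0"
  shows "quantum_torsional_rigidity G l =
    1 / 12 * (\<Sum>e\<in>arcs G. l e ^ 3) +
    1 / 4 * (1 / c ^ 3) * rw_torsional_rigidity (verts G) (discrete_weight G l c) (kirchhoff_verts G)"
proof -
  interpret quantum_graph G l by fact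
  obtain U where U: "is_potential G l U" using ex_potential[OF assms(3)] ..
  \<comment> \<open>Both rigidities are expressed through the same sum of
    \<open>U x * star_length G l x\<close>, and the coefficients agree:
    \<open>1/4 * (1 / c ^ 3) * (2 * c ^ 3) = 1/2\<close>.\<close>
  show ?thesis
    using assms(5)
    by (simp add: quantum_torsional_rigidity_eq[OF assms(3) U]
        rw_torsional_rigidity_eq[OF assms(2,3) U assms(5,6)])
qed

end
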